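(* Let $H$ be a subgroup of a finite group $G$ such that $Z(H, G) \ne H$. Then \[ \frac{1}{l_H}\left( 1 + \frac{l_H - 1}{|H : Z(H, G)|}\right) \leq \Pr(H, G) \leq \frac{1}{s_H}\left( 1 + \frac{s_H - 1}{|H : Z(H, G)|}\right), \] and in each of the two inequalities equality holds if and only if $s_H = l_H$ and $\operatorname{cs}(G, H) = \{1, s_H\}$.
   Context: For a finite group $G$ and a subgroup $H$ of $G$: $Z(H,G) := \{h \in H : hg = gh \text{ for all } g \in G\} = Z(G)\cap H$; for $x\in G$, $\mathrm{Cl}_G(x)$ is the conjugacy class of $x$ in $G$; $\operatorname{cs}(G,H) := \{|\mathrm{Cl}_G(x)| : x \in H\}$. When $Z(H,G)\neq H$, set $s_H := \min\{|\mathrm{Cl}_G(x)| : x\in H - Z(H,G)\}$ and $l_H := \max\{|\mathrm{Cl}_G(x)| : x\in H - Z(H,G)\}$, where $H - Z(H,G)$ is the set difference. The relative commutativity degree is \[ \Pr(H,G) := \frac{|\{(x,y)\in H\times G : xy = yx\}|}{|H||G|}. \] *)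

theory Defs
  imports Complex_Main "HOL-Algebra.Group_Action"
begin

definition rel_center :: "'a set \<Rightarrow> ('a, 'b) monoid_scheme \<Rightarrow> 'a set"
  where "rel_center H G = {h \<in> H. \<forall>g \<in> carrier G. h \<otimes>\<^bsub>G\<^esub> g = g \<otimes>\<^bsub>G\<^esub> h}"

(* The orbit of x under the action of group.action_by_conjugation. *)
definition conj_class :: "('a, 'b) monoid_scheme \<Rightarrow> 'a \<Rightarrow> 'a set"
  where "conj_class G x =
    orbit G (\<lambda>g. \<lambda>h \<in> carrier G. g \<otimes>\<^bsub>G\<^esub> h \<otimes>\<^bsub>G\<^esub> (inv\<^bsub>G\<^esub> g)) x"

definition class_sizes :: "('a, 'b) monoid_scheme \<Rightarrow> 'a set \<Rightarrow> nat set"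
  where "class_sizes G H = {card (conj_class G x) | x. x \<in> H}"

(* The next two are meaningful only for finite G and rel_center H G \<noteq> H:
   otherwise Min and Max may be taken over an empty or infinite set. *)
definition min_class_size :: "'a set \<Rightarrow> ('a, 'b) monoid_scheme \<Rightarrow> nat"
  where "min_class_size H G = Min {card (conj_class G x) | x. x \<in> H - rel_center H G}"

definition max_class_size :: "'a set \<Rightarrow> ('a, 'b) monoid_scheme \<Rightarrow> nat"
  where "max_class_size H G = Max {card (conj_class G x) | x. x \<in> H - rel_center H G}"

(* The cosets are taken inside H, regarded as a group in its own right. *)
definition rel_index :: "('a, 'b) monoid_scheme \<Rightarrow> 'a set \<Rightarrow> 'a set \<Rightarrow> nat"
  where "rel_index G H K = card (rcosets\<^bsub>G\<lparr>carrier := H\<rparr>\<^esub> K)"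

definition rel_comm_degree :: "'a set \<Rightarrow> ('a, 'b) monoid_scheme \<Rightarrow> real"
  where "rel_comm_degree H G =
    real (card {(x, y) \<in> H \<times> carrier G. x \<otimes>\<^bsub>G\<^esub> y = y \<otimes>\<^bsub>G\<^esub> x}) / (real (card H) * real (order G))"

end

theory Submission
  imports Defs
begin

text \<open>
  Write \<open>c x\<close> for the size of the conjugacy class of \<open>x\<close>. By the orbit-stabilizer theorem,
  applied to conjugation, \<open>x\<close> commutes with exactly \<open>|G| / c x\<close> elements of \<open>G\<close>, so counting
  commuting pairs one row at a time shows that \<open>Pr(H, G)\<close> is the average of \<open>1 / c x\<close> over
  \<open>x \<in> H\<close> (lemma \<open>rel_comm_degree_eq_average\<close>). Every \<open>x\<close> in \<open>Z = Z(H, G)\<close> has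
  \<open>c x = 1\<close>, hence
  \[ |H| \cdot Pr(H, G) = |Z| + \sum_{x \in H - Z} 1 / c(x). \]
  By Lagrange's theorem, both bounds of the theorem arise from this expression when every
  \<open>c x\<close> in the sum is replaced by one number \<open>k\<close> (lemma \<open>index_bound_eq\<close>): by the maximum
  for the lower bound, by the minimum for the upper one. So the inequalities
  hold term by term, and either of them is an equality exactly when \<open>c\<close> is constant on
  \<open>H - Z\<close>, that is, when its minimum and maximum there agree. As \<open>c\<close> is \<open>1\<close> on the nonempty
  set \<open>Z\<close>, the class sizes met by \<open>H\<close> are in this case exactly \<open>1\<close> and the common value.
\<close>

section \<open>Conjugacy classes and the commutativity degree\<close>

lemma (in group) conj_class_eq:
  assumes "x \<in> carrier G"
  shows "conj_class G x = {g \<otimes> x \<otimes> inv g | g. g \<in> carrier G}"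
  using assms unfolding conj_class_def orbit_def by auto

lemma (in group) conj_fixes_iff_commutes:
  assumes "x \<in> carrier G" "g \<in> carrier G"
  shows "g \<otimes> x \<otimes> inv g = x \<longleftrightarrow> x \<otimes> g = g \<otimes> x"
  using assms inv_solve_right'[of x "g \<otimes> x" g] by auto

text \<open>This is the orbit-stabilizer theorem: the stabilizer of \<open>x\<close> under conjugation is its
  centralizer.\<close>

lemma (in group) card_conj_class_times_centralizer:
  assumes "x \<in> carrier G"
  shows "card (conj_class G x) * card {y \<in> carrier G. x \<otimes> y = y \<otimes> x} = order G"
proof -
  let ?act = "\<lambda>g. \<lambda>h \<in> carrier G. g \<otimes> h \<otimes> inv g"
  interpret conj: group_action G "carrier G" ?act
    by (rule action_by_conjugation)
  have "stabilizer G ?act x = {y \<in> carrier G. x \<otimes> y = y \<otimes> x}"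
    using assms conj_fixes_iff_commutes by (auto simp: stabilizer_def)
  then show ?thesis
    using conj.orbit_stabilizer_theorem[OF assms] by (simp add: conj_class_def)
qed

lemma (in group) card_conj_class_pos:
  assumes "finite (carrier G)" "x \<in> carrier G"
  shows "0 < card (conj_class G x)"
  using card_conj_class_times_centralizer[OF assms(2)] order_gt_0_iff_finite assms(1)
  by (metis mult_is_0 neq0_conv)

lemma (in group) card_conj_class_eq_1:
  assumes "x \<in> rel_center H G" "H \<subseteq> carrier G"
  shows "card (conj_class G x) = 1"
proof -
  have x: "x \<in> carrier G" and comm: "\<And>g. g \<in> carrier G \<Longrightarrow> x \<otimes> g = g \<otimes> x"
    using assms by (auto simp: rel_center_def)
  have "g \<otimes> x \<otimes> inv g = x" if "g \<in> carrier G" for g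
    using conj_fixes_iff_commutes[OF x that] comm[OF that] by simp
  then have "conj_class G x = {x}"
    unfolding conj_class_eq[OF x] using x by (auto intro!: exI[of _ \<one>])
  then show ?thesis by simp
qed

lemma (in group) rel_center_subgroup:
  assumes "subgroup H G"
  shows "subgroup (rel_center H G) G"
proof -
  interpret H: subgroup H G by (rule assms)
  show ?thesis
  proof (rule subgroupI)
    show "rel_center H G \<subseteq> carrier G"
      using H.subset by (auto simp: rel_center_def)
    show "rel_center H G \<noteq> {}"
      using H.one_closed by (auto simp: rel_center_def intro!: exI[of _ \<one>])
  next
    fix a assume a: "a \<in> rel_center H G"
    have "inv a \<otimes> g = g \<otimes> inv a" if g: "g \<in> carrier G" for g
    proof -
      have aG: "a \<in> carrier G" and ag: "a \<otimes> g = g \<otimes> a"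
        using a g H.mem_carrier by (auto simp: rel_center_def)
      have "inv a \<otimes> g = inv a \<otimes> (g \<otimes> a) \<otimes> inv a"
        using aG g by (simp add: m_assoc)
      also have "\<dots> = g \<otimes> inv a"
        using aG g by (simp add: ag[symmetric] m_assoc[symmetric])
      finally show ?thesis .
    qed
    with a show "inv a \<in> rel_center H G"
      by (simp add: rel_center_def)
  next
    fix a b assume ab: "a \<in> rel_center H G" "b \<in> rel_center H G"
    have "(a \<otimes> b) \<otimes> g = g \<otimes> (a \<otimes> b)" if g: "g \<in> carrier G" for g
    proof -
      have *: "a \<in> carrier G" "b \<in> carrier G" "a \<otimes> g = g \<otimes> a" "b \<otimes> g = g \<otimes> b"
        using ab g H.mem_carrier by (auto simp: rel_center_def)
      have "(a \<otimes> b) \<otimes> g = a \<otimes> (g \<otimes> b)"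
        using * g by (simp add: m_assoc)
      also have "\<dots> = (g \<otimes> a) \<otimes> b"
        using *(1,2) g by (simp add: m_assoc[symmetric] *(3))
      also have "\<dots> = g \<otimes> (a \<otimes> b)"
        using *(1,2) g by (simp add: m_assoc)
      finally show ?thesis .
    qed
    moreover have "a \<otimes> b \<in> H"
      using ab H.m_closed unfolding rel_center_def by blast
    ultimately show "a \<otimes> b \<in> rel_center H G"
      unfolding rel_center_def by blast
  qed
qed

lemma (in group) rel_index_times_card:
  assumes "subgroup H G" "subgroup K G" "K \<subseteq> H"
  shows "rel_index G H K * card K = card H"
proof -
  have "group (G\<lparr>carrier := H\<rparr>)"
    using assms(1) by (rule subgroup_imp_group)
  moreover have "subgroup K (G\<lparr>carrier := H\<rparr>)"
    using assms subgroup_incl by blast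
  ultimately show ?thesis
    using group.lagrange by (fastforce simp: rel_index_def order_def)
qed

text \<open>The commuting pairs with first component \<open>x\<close> number \<open>|G| / |Cl(x)|\<close>.\<close>

lemma (in group) rel_comm_degree_eq_average:
  assumes "finite (carrier G)" "H \<subseteq> carrier G"
  shows "rel_comm_degree H G = (\<Sum>x\<in>H. 1 / real (card (conj_class G x))) / real (card H)"
proof -
  have finH: "finite H"
    using assms finite_subset by blast
  have "{(x, y) \<in> H \<times> carrier G. x \<otimes> y = y \<otimes> x}
      = (SIGMA x:H. {y \<in> carrier G. x \<otimes> y = y \<otimes> x})"
    by auto
  then have "real (card {(x, y) \<in> H \<times> carrier G. x \<otimes> y = y \<otimes> x})
      = (\<Sum>x\<in>H. real (card {y \<in> carrier G. x \<otimes> y = y \<otimes> x}))"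
    using finH assms(1) by simp
  also have "\<dots> = (\<Sum>x\<in>H. real (order G) * (1 / real (card (conj_class G x))))"
  proof (rule sum.cong)
    fix x assume "x \<in> H"
    then have x: "x \<in> carrier G"
      using assms(2) by blast
    show "real (card {y \<in> carrier G. x \<otimes> y = y \<otimes> x})
        = real (order G) * (1 / real (card (conj_class G x)))"
      using card_conj_class_pos[OF assms(1) x]
      unfolding card_conj_class_times_centralizer[OF x, symmetric] by simp
  qed simp
  also have "\<dots> = real (order G) * (\<Sum>x\<in>H. 1 / real (card (conj_class G x)))"
    by (simp add: sum_distrib_left)
  finally show ?thesis
    using assms(1) order_gt_0_iff_finite by (simp add: rel_comm_degree_def)
qed

text \<open>Central elements have singleton classes, so each of them contributes \<open>1\<close> to the sum.\<close>

lemma (in group) rel_comm_degree_split_center: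
  assumes "finite (carrier G)" "H \<subseteq> carrier G"
  shows "rel_comm_degree H G
    = (real (card (rel_center H G))
        + (\<Sum>x\<in>H - rel_center H G. 1 / real (card (conj_class G x)))) / real (card H)"
proof -
  have "finite H" "rel_center H G \<subseteq> H"
    using assms finite_subset by (auto simp: rel_center_def)
  then have "(\<Sum>x\<in>H. 1 / real (card (conj_class G x)))
      = (\<Sum>x\<in>H - rel_center H G. 1 / real (card (conj_class G x)))
        + (\<Sum>x\<in>rel_center H G. 1 / real (card (conj_class G x)))"
    by (rule sum.subset_diff[rotated])
  moreover have "(\<Sum>x\<in>rel_center H G. 1 / real (card (conj_class G x)))
      = real (card (rel_center H G))"
    using card_conj_class_eq_1 assms(2) by simp
  ultimately show ?thesis
    by (simp add: rel_comm_degree_eq_average[OF assms])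
qed

section \<open>Replacing all class sizes by a constant\<close>

text \<open>The bounds of the theorem have the form of the left-hand side, with \<open>i = |H : Z|\<close>,
  \<open>z = |Z|\<close>, and \<open>k\<close> an extremal class size; the right-hand side is the average
  in which every noncentral element contributes \<open>1 / k\<close>.\<close>

lemma index_bound_eq:
  fixes i z k :: real
  assumes "i \<noteq> 0" "z \<noteq> 0" "k \<noteq> 0"
  shows "1 / k * (1 + (k - 1) / i) = (z + (i * z - z) * (1 / k)) / (i * z)"
  using assms by (simp add: field_simps)

lemma sum_eq_card_times_bound_iff:
  fixes f :: "'a \<Rightarrow> real"
  assumes "finite A" and "(\<forall>x\<in>A. f x \<le> b) \<or> (\<forall>x\<in>A. b \<le> f x)"
  shows "sum f A = real (card A) * b \<longleftrightarrow> (\<forall>x\<in>A. f x = b)"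
proof
  assume eq: "sum f A = real (card A) * b"
  then have eq': "sum f A = (\<Sum>x\<in>A. b)" by simp
  from assms(2) show "\<forall>x\<in>A. f x = b"
  proof
    assume "\<forall>x\<in>A. f x \<le> b"
    then show ?thesis
      using sum_mono_inv[OF eq'] assms(1) by blast
  next
    assume "\<forall>x\<in>A. b \<le> f x"
    then show ?thesis
      using sum_mono_inv[OF eq'[symmetric]] assms(1) by force
  qed
qed simp

lemma constant_iff_Min_eq_Max:
  fixes c :: "'a \<Rightarrow> 'b::linorder"
  assumes "finite A" "A \<noteq> {}"
  shows "(\<forall>x\<in>A. c x = Min (c ` A)) \<longleftrightarrow> Min (c ` A) = Max (c ` A)"
    and "(\<forall>x\<in>A. c x = Max (c ` A)) \<longleftrightarrow> Min (c ` A) = Max (c ` A)"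
proof -
  have bounds: "Min (c ` A) \<le> c x" "c x \<le> Max (c ` A)" if "x \<in> A" for x
    using assms that by auto
  have attained: "Min (c ` A) \<in> c ` A" "Max (c ` A) \<in> c ` A"
    using assms by auto
  have const: "c x = Min (c ` A) \<and> c x = Max (c ` A)" if "Min (c ` A) = Max (c ` A)" "x \<in> A" for x
    using bounds[OF that(2)] that(1) by (metis order.antisym)
  show "(\<forall>x\<in>A. c x = Min (c ` A)) \<longleftrightarrow> Min (c ` A) = Max (c ` A)"
    using attained(2) const by (metis imageE)
  show "(\<forall>x\<in>A. c x = Max (c ` A)) \<longleftrightarrow> Min (c ` A) = Max (c ` A)"
    using attained(1) const by (metis imageE)
qed

section \<open>Bounds for the relative commutativity degree\<close>

theorem theorem4p1:
  fixes G :: "('a, 'b) monoid_scheme" and H :: "'a set"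
  assumes "group G" and "finite (carrier G)"
    and "subgroup H G"
    and "rel_center H G \<noteq> H"
  shows "1 / real (max_class_size H G)
           * (1 + (real (max_class_size H G) - 1) / real (rel_index G H (rel_center H G)))
         \<le> rel_comm_degree H G
    \<and> rel_comm_degree H G
         \<le> 1 / real (min_class_size H G)
           * (1 + (real (min_class_size H G) - 1) / real (rel_index G H (rel_center H G)))
    \<and> (1 / real (max_class_size H G)
           * (1 + (real (max_class_size H G) - 1) / real (rel_index G H (rel_center H G)))
         = rel_comm_degree H G
       \<longleftrightarrow> min_class_size H G = max_class_size H G
           \<and> class_sizes G H = {1, min_class_size H G})
    \<and> (rel_comm_degree H G
         = 1 / real (min_class_size H G)
           * (1 + (real (min_class_size H G) - 1) / real (rel_index G H (rel_center H G)))
       \<longleftrightarrow> min_class_size H G = max_class_size H G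
           \<and> class_sizes G H = {1, min_class_size H G})"
proof -
  interpret group G by fact
  let ?Z = "rel_center H G"
  let ?c = "\<lambda>x. card (conj_class G x)"
  define N where "N = H - ?Z"
  define i where "i = real (rel_index G H ?Z)"
  define s where "s = min_class_size H G"
  define l where "l = max_class_size H G"
  define S where "S = (\<Sum>x\<in>N. 1 / real (?c x))"
  have HG: "H \<subseteq> carrier G"
    using assms(3) by (rule subgroup.subset)
  have ZH: "?Z \<subseteq> H"
    by (auto simp: rel_center_def)
  have finH: "finite H"
    using HG assms(2) finite_subset by blast
  then have finZ: "finite ?Z"
    using ZH finite_subset by blast
  have N: "finite N" "N \<noteq> {}" "N \<subseteq> carrier G"
    using finH ZH HG assms(4) by (auto simp: N_def)

  have oneZ: "\<one>\<^bsub>G\<^esub> \<in> ?Z"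
    using rel_center_subgroup[OF assms(3)] by (rule subgroup.one_closed)
  have z: "real (card ?Z) > 0"
    using oneZ finZ card_gt_0_iff by fastforce
  have H: "real (card H) > 0"
    using oneZ ZH finH card_gt_0_iff by fastforce
  have iz: "i * real (card ?Z) = real (card H)"
    using rel_index_times_card[OF assms(3) rel_center_subgroup[OF assms(3)] ZH]
    by (metis i_def of_nat_mult)
  then have i: "i \<noteq> 0"
    using H by auto
  have cardN: "real (card N) = real (card H) - real (card ?Z)"
    using finZ ZH finH by (simp add: N_def card_Diff_subset card_mono of_nat_diff)

  have s_Min: "s = Min (?c ` N)" and l_Max: "l = Max (?c ` N)"
    by (simp_all add: s_def l_def min_class_size_def max_class_size_def N_def
        Setcompr_eq_image[symmetric])
  have c_pos: "0 < ?c x" if "x \<in> N" for x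
    using that N(3) card_conj_class_pos[OF assms(2)] by blast
  have "s \<in> ?c ` N" "l \<in> ?c ` N"
    using N by (simp_all add: s_Min l_Max)
  then have sl: "0 < s" "0 < l"
    using c_pos by auto
  have cs: "s \<le> ?c x" "?c x \<le> l" if "x \<in> N" for x
    using that N by (auto simp: s_Min l_Max)

  have degree: "rel_comm_degree H G = (real (card ?Z) + S) / real (card H)"
    using rel_comm_degree_split_center[OF assms(2) HG] by (simp add: S_def N_def)
  have bound: "1 / real k * (1 + (real k - 1) / i)
      = (real (card ?Z) + real (card N) * (1 / real k)) / real (card H)" if "0 < k" for k
    using index_bound_eq[OF i, of "real (card ?Z)" "real k"] z that by (simp add: iz cardN)

  have inv_upper: "1 / real (?c x) \<le> 1 / real s" if "x \<in> N" for x
    using cs(1)[OF that] sl by (simp add: frac_le)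
  have inv_lower: "1 / real l \<le> 1 / real (?c x)" if "x \<in> N" for x
    using cs(2)[OF that] c_pos[OF that] by (simp add: frac_le)
  have upper: "S \<le> real (card N) * (1 / real s)"
    unfolding S_def using inv_upper by (intro sum_bounded_above) auto
  have lower: "real (card N) * (1 / real l) \<le> S"
    unfolding S_def using inv_lower by (intro sum_bounded_below) auto
  have "S = real (card N) * (1 / real s) \<longleftrightarrow> (\<forall>x\<in>N. 1 / real (?c x) = 1 / real s)"
    unfolding S_def using inv_upper N(1) by (intro sum_eq_card_times_bound_iff) auto
  then have upper_eq: "S = real (card N) * (1 / real s) \<longleftrightarrow> s = l"
    using constant_iff_Min_eq_Max(1)[OF N(1,2), of ?c] by (simp add: s_Min l_Max)
  have "S = real (card N) * (1 / real l) \<longleftrightarrow> (\<forall>x\<in>N. 1 / real (?c x) = 1 / real l)"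
    unfolding S_def using inv_lower N(1) by (intro sum_eq_card_times_bound_iff) auto
  then have lower_eq: "S = real (card N) * (1 / real l) \<longleftrightarrow> s = l"
    using constant_iff_Min_eq_Max(2)[OF N(1,2), of ?c] by (simp add: s_Min l_Max)

  \<comment> \<open>Both values occur because neither \<open>Z\<close> nor \<open>H - Z\<close> is empty.\<close>
  have sizes: "class_sizes G H = {1, s}" if "s = l"
  proof -
    have "class_sizes G H = ?c ` ?Z \<union> ?c ` N"
      using ZH by (auto simp: class_sizes_def N_def)
    moreover have "?c ` ?Z = {1}"
      using oneZ card_conj_class_eq_1[OF _ HG] by force
    moreover have "?c ` N = {s}"
      using that cs N(2) by (force intro: antisym)
    ultimately show ?thesis by auto
  qed

  show ?thesis
    unfolding s_def[symmetric] l_def[symmetric] i_def[symmetric]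
      bound[OF sl(1)] bound[OF sl(2)] degree
    using upper lower upper_eq lower_eq sizes H
    by (auto simp: divide_right_mono)
qed

end
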